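(* For every integer $n\ge 2$ there exists a plurisubharmonic function $\varphi$ on $\mathbb{C}^n$ such that $1$ is a cluster point of $\mathrm{Jump}(\varphi;o)$, where $o$ is the origin of $\mathbb{C}^n$.
   Context: For a plurisubharmonic function $\varphi$ on a complex manifold $X$, the multiplier ideal sheaf $\mathscr{I}(\varphi)$ is the sheaf of germs of holomorphic functions $f$ such that $|f|^2e^{-2\varphi}$ is locally integrable; $\mathscr{I}(\varphi)_x$ denotes its stalk at $x$. For $c\ge 0$, $\mathscr{I}(c\varphi)$ is the multiplier ideal sheaf of $c\varphi$ (with $\mathscr{I}(0\cdot\varphi)_x=\mathcal{O}_{X,x}$). As $c$ increases, the ideals $\mathscr{I}(c\varphi)_x$ decrease and, by the strong openness property, for each $c$ one has $\mathscr{I}(c'\varphi)_x=\mathscr{I}(c\varphi)_x$ for all $c'\ge c$ sufficiently close to $c$. The jumping coefficients of $\varphi$ at $x$ are the values of $c$ at which the ideal changes: a real number $\xi>0$ is a jumping coefficient of $\varphi$ at $x$ if $\mathscr{I}(\xi\varphi)_x\subsetneq\mathscr{I}(c\varphi)_x$ for every $0\le c<\xi$. The set of all jumping coefficients of $\varphi$ at $x$ is denoted $\mathrm{Jump}(\varphi;x)$. A number $\xi$ is called a cluster point of $\mathrm{Jump}(\varphi;x)$ if $\xi$ is itself a jumping coefficient of $\varphi$ at $x$ and for every sufficiently small $\varepsilon>0$ there is a jumping coefficient of $\varphi$ at $x$ in the interval $(\xi-\varepsilon,\xi)$. *)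

theory Defs
  imports "HOL-Analysis.Analysis"
begin

text \<open>
  Complex affine space of dimension \<open>n = CARD('n)\<close> is \<^typ>\<open>complex ^ 'n\<close>, with the standard Lebesgue
  measure \<^term>\<open>lborel\<close>. Plurisubharmonic functions take values in \<open>[-\<infinity>, \<infinity>)\<close> and are functions to
  \<^typ>\<open>ereal\<close>.
\<close>

definition upper_semicontinuous_on :: "'a::topological_space set \<Rightarrow> ('a \<Rightarrow> ereal) \<Rightarrow> bool" where
  "upper_semicontinuous_on S u \<longleftrightarrow>
     (\<forall>z\<in>S. \<forall>t. u z < t \<longrightarrow> (\<forall>\<^sub>F w in at z within S. u w < t))"

text \<open>
  The mean over a circle is the extended Lebesgue integral, the integral of the positive part minus
  that of the negative part: \<^const>\<open>e2ennreal\<close> sends negative values to \<open>0\<close>. It is used for functions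
  that are bounded above on the circle, where the first integral is finite and the difference lies
  in \<open>[-\<infinity>, \<infinity>)\<close>.
\<close>

definition circle_mean :: "(complex \<Rightarrow> ereal) \<Rightarrow> complex \<Rightarrow> real \<Rightarrow> ereal" where
  "circle_mean u z r =
     (enn2ereal (\<integral>\<^sup>+\<theta>\<in>{0..2 * pi}. e2ennreal (u (z + of_real r * cis \<theta>)) \<partial>lborel)
      - enn2ereal (\<integral>\<^sup>+\<theta>\<in>{0..2 * pi}. e2ennreal (- u (z + of_real r * cis \<theta>)) \<partial>lborel))
     / ereal (2 * pi)"

text \<open>
  For open \<open>S\<close>. The function that is constantly \<open>-\<infinity>\<close> on a component is admitted here, because it
  occurs as the restriction of a plurisubharmonic function to a complex line.
\<close>

definition subharmonic_on :: "complex set \<Rightarrow> (complex \<Rightarrow> ereal) \<Rightarrow> bool" where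
  "subharmonic_on S u \<longleftrightarrow>
     (\<forall>z\<in>S. u z < \<infinity>) \<and> upper_semicontinuous_on S u \<and>
     (\<forall>z r. 0 < r \<and> cball z r \<subseteq> S \<longrightarrow> u z \<le> circle_mean u z r)"

definition plurisubharmonic_on :: "(complex ^ 'n) set \<Rightarrow> (complex ^ 'n \<Rightarrow> ereal) \<Rightarrow> bool" where
  "plurisubharmonic_on U \<phi> \<longleftrightarrow>
     open U \<and> (\<forall>z\<in>U. \<phi> z < \<infinity>) \<and> upper_semicontinuous_on U \<phi> \<and>
     (\<forall>a b. subharmonic_on {\<zeta>. a + \<zeta> *s b \<in> U} (\<lambda>\<zeta>. \<phi> (a + \<zeta> *s b))) \<and>
     (\<forall>C\<in>components U. \<exists>z\<in>C. \<phi> z \<noteq> - \<infinity>)"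

text \<open>Holomorphy in several variables: real differentiability with complex-linear derivative.\<close>

definition holomorphic_several_on :: "(complex ^ 'n \<Rightarrow> complex) \<Rightarrow> (complex ^ 'n) set \<Rightarrow> bool" where
  "holomorphic_several_on f U \<longleftrightarrow>
     (\<forall>z\<in>U. \<exists>D. (f has_derivative D) (at z) \<and> (\<forall>c v. D (c *s v) = c * D v))"

definition germ_at :: "'a::topological_space \<Rightarrow> ('a \<Rightarrow> 'b) \<Rightarrow> ('a \<Rightarrow> 'b) set" where
  "germ_at x f = {g. \<forall>\<^sub>F z in nhds x. g z = f z}"

text \<open>
  The exponential on \<open>[-\<infinity>, \<infinity>]\<close>; the weight \<open>e\<^sup>-\<^sup>2\<^sup>\<phi>\<close> is \<open>\<infinity>\<close> where \<open>\<phi> = -\<infinity>\<close>. At such points with \<open>f = 0\<close>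
  the product \<open>|f|\<^sup>2 e\<^sup>-\<^sup>2\<^sup>\<phi>\<close> below is \<open>0 * \<infinity> = 0\<close>; for plurisubharmonic \<open>\<phi>\<close> this convention only matters
  on a null set.
\<close>

definition exp_ereal :: "ereal \<Rightarrow> ennreal" where
  "exp_ereal t = (if t = \<infinity> then \<infinity> else if t = - \<infinity> then 0 else ennreal (exp (real_of_ereal t)))"

definition multiplier_ideal_sections ::
    "(complex ^ 'n \<Rightarrow> ereal) \<Rightarrow> (complex ^ 'n) set \<Rightarrow> (complex ^ 'n \<Rightarrow> complex) set" where
  "multiplier_ideal_sections \<phi> U =
     {f. holomorphic_several_on f U \<and>
         (\<forall>K. compact K \<and> K \<subseteq> U \<longrightarrow>
            (\<integral>\<^sup>+z\<in>K. ennreal ((cmod (f z))\<^sup>2) * exp_ereal (- 2 * \<phi> z) \<partial>lborel) < \<infinity>)}"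

definition multiplier_ideal_stalk ::
    "(complex ^ 'n \<Rightarrow> ereal) \<Rightarrow> complex ^ 'n \<Rightarrow> (complex ^ 'n \<Rightarrow> complex) set set" where
  "multiplier_ideal_stalk \<phi> x =
     {germ_at x f |f. \<exists>U. open U \<and> x \<in> U \<and> f \<in> multiplier_ideal_sections \<phi> U}"

text \<open>
  For \<open>c = 0\<close> the product \<open>0 * \<phi>\<close> is \<open>0\<close> everywhere, also where \<open>\<phi> = -\<infinity>\<close> (as \<open>0 * -\<infinity> = 0\<close> in
  \<^typ>\<open>ereal\<close>), so that the stalk for \<open>c = 0\<close> consists of all holomorphic germs.
\<close>

definition Jump :: "(complex ^ 'n \<Rightarrow> ereal) \<Rightarrow> complex ^ 'n \<Rightarrow> real set" where
  "Jump \<phi> x =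
     {\<xi>. 0 < \<xi> \<and>
         (\<forall>c. 0 \<le> c \<and> c < \<xi> \<longrightarrow>
            multiplier_ideal_stalk (\<lambda>z. ereal \<xi> * \<phi> z) x \<subset>
            multiplier_ideal_stalk (\<lambda>z. ereal c * \<phi> z) x)}"

definition is_cluster_point_of_Jump :: "real \<Rightarrow> (complex ^ 'n \<Rightarrow> ereal) \<Rightarrow> complex ^ 'n \<Rightarrow> bool" where
  "is_cluster_point_of_Jump \<xi> \<phi> x \<longleftrightarrow>
     \<xi> \<in> Jump \<phi> x \<and> (\<forall>\<^sub>F \<epsilon> in at_right 0. \<exists>\<eta>\<in>Jump \<phi> x. \<xi> - \<epsilon> < \<eta> \<and> \<eta> < \<xi>)"

end

theory Submission
  imports Defs "HOL-Complex_Analysis.Cauchy_Integral_Formula"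
begin

text \<open>
  Write \<open>z\<close> and \<open>w\<close> for two distinct coordinates. The function is
  \<open>\<phi> = sup\<^sub>k ((1 + 1/k) log \<bar>z\<bar> + (k + 1) (log \<bar>w\<bar> - (k + 1)))\<close>, over \<open>k \<ge> 1\<close>.

  It is a toric function, and the idea comes from its Newton body. For \<open>\<phi>\<close> that depends only on \<open>log \<bar>z\<bar>\<close>
  and \<open>log \<bar>w\<bar>\<close>, the monomial \<open>w ^ b\<close> is expected to belong to the multiplier ideal of \<open>c \<phi>\<close> at the origin
  exactly if \<open>(1, b + 1)\<close> is interior to \<open>c P\<close>, where \<open>P\<close> is the convex set spanned by the exponent pairs and
  the directions of the positive quadrant. If the boundary of \<open>P\<close> approaches a vertical line \<open>x = 1\<close> without
  reaching it, then the critical values of \<open>c\<close> for the monomials \<open>w ^ b\<close> stay below \<open>1\<close> and tend to \<open>1\<close>. The exponent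
  pairs above lie on the hyperbola \<open>(x - 1) (y - 1) = 1\<close>, and are chosen such that for \<open>b = k - 1\<close> the point
  \<open>(1, k)\<close> is exactly \<open>k / (k + 1)\<close> times the \<open>k\<close>-th vertex. So the \<open>k\<close>-th term alone decides about
  \<open>w ^ (k - 1)\<close>, and both halves of the criterion become explicit estimates:

  \<^item> If \<open>c < k / (k + 1)\<close>, the \<open>k\<close>-th term bounds \<open>\<phi>\<close> from below well enough to make
    \<open>\<bar>w ^ (k - 1)\<bar>\<^sup>2 exp (- 2 c \<phi>)\<close> integrable near the origin (\<open>monomial_in_stalk\<close>).
  \<^item> If \<open>c = k / (k + 1)\<close>, this function has at least a fixed positive mass on each of
    infinitely many disjoint boxes along a ray in logarithmic coordinates that is normal to the hyperbola at
    the \<open>k\<close>-th vertex (\<open>monomial_not_integrable\<close>).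

  Hence the ideals change at every \<open>k / (k + 1)\<close>, and also at \<open>1\<close>, because the ideal of \<open>\<phi>\<close> itself contains none
  of these monomials.

  Plurisubharmonicity of \<open>\<phi>\<close> on the whole space comes down to the submean inequality for the logarithm of an
  affine function on a circle, possibly with its zero on that circle (\<open>log_circle\<close>).
\<close>

section \<open>Circle means of logarithms\<close>

abbreviation angle_measure :: "real measure" where
  "angle_measure \<equiv> restrict_space lborel {0..2 * pi}"

text \<open>
  A mean of extended real values cannot be computed by linearity. It is enough to bound it from below
  by the integral of an integrable real function, where almost everywhere suffices: the functions in
  question are \<open>-\<infinity>\<close> at finitely many points of the circle.
\<close>

lemma circle_mean_ge:
  fixes c :: real
  assumes int: "integrable angle_measure v"
    and le: "AE \<theta> in angle_measure. ereal (v \<theta>) \<le> u (z + of_real r * cis \<theta>)"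
    and c: "2 * pi * c \<le> integral\<^sup>L angle_measure v"
  shows "ereal c \<le> circle_mean u z r"
proof -
  let ?P = "\<integral>\<^sup>+\<theta>. e2ennreal (u (z + of_real r * cis \<theta>)) \<partial>angle_measure"
  let ?N = "\<integral>\<^sup>+\<theta>. e2ennreal (- u (z + of_real r * cis \<theta>)) \<partial>angle_measure"
  let ?p = "\<integral>\<^sup>+\<theta>. ennreal (v \<theta>) \<partial>angle_measure"
  let ?n = "\<integral>\<^sup>+\<theta>. ennreal (- v \<theta>) \<partial>angle_measure"
  have "?p \<le> ?P"
    by (rule nn_integral_mono_AE, use le in eventually_elim) (metis e2ennreal_ereal e2ennreal_mono)
  then have pP: "enn2ereal ?p \<le> enn2ereal ?P" by (simp add: less_eq_ennreal.rep_eq)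
  have "?N \<le> ?n"
    by (rule nn_integral_mono_AE, use le in eventually_elim)
       (metis e2ennreal_ereal e2ennreal_mono ereal_minus_le_minus uminus_ereal.simps(1))
  then have nN: "enn2ereal ?N \<le> enn2ereal ?n" by (simp add: less_eq_ennreal.rep_eq)
  have fin: "?p < \<infinity>" "?n < \<infinity>"
    using int by (auto simp: real_integrable_def top.not_eq_extremum)
  have fr: "ereal (enn2real x) = enn2ereal x" if "x < \<infinity>" for x
    using that by (cases x) (auto simp: enn2ereal_ennreal)
  have "ereal (2 * pi * c) \<le> ereal (integral\<^sup>L angle_measure v)" using c by simp
  also have "\<dots> = ereal (enn2real ?p) - ereal (enn2real ?n)"
    using int by (simp add: real_lebesgue_integral_def)
  also have "\<dots> = enn2ereal ?p - enn2ereal ?n"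
    using fin fr by simp
  also have "\<dots> \<le> enn2ereal ?P - enn2ereal ?N"
    by (rule ereal_minus_mono[OF pP nN])
  finally have "ereal (2 * pi * c) / ereal (2 * pi) \<le> (enn2ereal ?P - enn2ereal ?N) / ereal (2 * pi)"
    by (rule ereal_divide_right_mono) (simp add: pi_gt_zero)
  then show ?thesis
    unfolding circle_mean_def by (simp add: nn_integral_restrict_space)
qed

text \<open>
  For \<open>\<bar>\<gamma>\<bar> < 1\<close> the integrand is the real part of \<open>Ln (1 + \<gamma> w)\<close>, holomorphic on the closed unit disc and
  zero at its centre, so this is the mean value property.
\<close>

lemma log_circle_inside:
  assumes "cmod \<gamma> < 1"
  shows "integrable angle_measure (\<lambda>\<theta>. ln (cmod (1 + \<gamma> * cis \<theta>)))"
    and "integral\<^sup>L angle_measure (\<lambda>\<theta>. ln (cmod (1 + \<gamma> * cis \<theta>))) = 0"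
proof -
  let ?f = "\<lambda>\<theta>. ln (cmod (1 + \<gamma> * cis \<theta>))"
  have pos: "0 < Re (1 + \<gamma> * w)" if "cmod w \<le> 1" for w
  proof -
    have "cmod (\<gamma> * w) < 1"
      using assms that by (metis mult_left_le norm_ge_zero norm_mult order_le_less_trans)
    then show ?thesis using abs_Re_le_cmod[of "\<gamma> * w"] by simp
  qed
  have nz: "1 + \<gamma> * cis t \<noteq> 0" for t using pos[of "cis t"] by (metis less_irrefl norm_cis order_refl zero_complex.sel(1))
  have cont: "continuous_on {0..2 * pi} ?f"
    by (intro continuous_intros) (auto simp: nz)
  have hol: "(\<lambda>w. Ln (1 + \<gamma> * w)) holomorphic_on cball 0 1"
    by (intro holomorphic_intros) (use pos in \<open>force simp: complex_nonpos_Reals_iff\<close>)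
  have "((\<lambda>w. Ln (1 + \<gamma> * w) / (w - 0)) has_contour_integral 2 * of_real pi * \<i> * Ln (1 + \<gamma> * 0)) (circlepath 0 1)"
    by (rule Cauchy_integral_circlepath_simple[OF hol]) simp
  then have "((\<lambda>t. \<i> * Ln (1 + \<gamma> * cis t)) has_integral 0) {0..2*pi}"
    unfolding circlepath_def by (subst (asm) has_contour_integral_part_circlepath_iff) (auto simp: mult_ac)
  from has_integral_linear[OF this bounded_linear_Im]
  have "((\<lambda>t. Im (\<i> * Ln (1 + \<gamma> * cis t))) has_integral Im 0) {0..2*pi}"
    by (simp only: o_def)
  then have hi: "(?f has_integral 0) {0..2*pi}" using nz by simp
  have si: "set_integrable lborel {0..2 * pi} ?f"
    using cont by (rule borel_integrable_atLeastAtMost')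
  then show "integrable angle_measure ?f"
    by (simp add: integrable_restrict_space set_integrable_def)
  show "integral\<^sup>L angle_measure ?f = 0"
    using set_borel_integral_eq_integral(2)[OF si] hi
    by (simp add: integral_restrict_space set_lebesgue_integral_def integral_unique)
qed

lemma AE_cis_neq: "AE \<theta> in angle_measure. cis \<theta> \<noteq> c"
proof -
  have "{\<theta>. cis \<theta> = c} \<subseteq> range (\<lambda>n::int. Arg c + 2 * pi * n)"
  proof (clarsimp)
    fix t assume "c = cis t"
    then have "cis t = cis (Arg (cis t))" by (simp add: cis_Arg)
    then show "t \<in> range (\<lambda>n::int. Arg (cis t) + 2 * pi * n)"
      using sin_cos_eq_iff[of t "Arg (cis t)"] by (metis cis.sel rangeI)
  qed
  then have "countable {\<theta>. cis \<theta> = c}" by (rule countable_subset) simp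
  then have "AE \<theta> in lborel. cis \<theta> \<noteq> c"
    using countable_imp_null_set_lborel AE_not_in by fastforce
  then show ?thesis by (subst AE_restrict_space_iff) auto
qed

lemma measure_angle: "measure angle_measure (space angle_measure) = 2 * pi"
  by (simp add: measure_restrict_space space_restrict_space)

lemma integrable_angle_const: "integrable angle_measure (\<lambda>_. c::real)"
  by (simp add: integrable_restrict_space)

lemma integral_angle_const: "integral\<^sup>L angle_measure (\<lambda>_. c::real) = 2 * pi * c"
  using measure_angle by simp

text \<open>
  The submean inequality for \<open>log \<bar>1 + \<gamma> w\<bar>\<close> at the centre of the unit circle, which by scaling is the one
  for the logarithm of any affine function. For \<open>\<bar>\<gamma>\<bar> > 1\<close>, reflection in the circle reduces it to
  the mean value property. For \<open>\<bar>\<gamma>\<bar> = 1\<close> there is a singularity on the circle, which is reached by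
  monotone convergence.
\<close>

lemma log_circle:
  fixes \<gamma> :: complex
  shows "integrable angle_measure (\<lambda>\<theta>. ln (cmod (1 + \<gamma> * cis \<theta>)))" (is ?A)
    and "0 \<le> integral\<^sup>L angle_measure (\<lambda>\<theta>. ln (cmod (1 + \<gamma> * cis \<theta>)))" (is ?B)
proof -
  consider "cmod \<gamma> < 1" | "cmod \<gamma> > 1" | "cmod \<gamma> = 1" by linarith
  then have "?A \<and> ?B"
  proof cases
    case 1
    with log_circle_inside[OF 1] show ?thesis by simp
  next
    case 2
    then have g0: "\<gamma> \<noteq> 0" by auto
    let ?g = "cnj (inverse \<gamma>)"
    have g1: "cmod ?g < 1" using 2 by (simp add: norm_inverse inverse_less_1_iff del: complex_cnj_inverse)
    have eq: "ln (cmod (1 + \<gamma> * cis t)) = ln (cmod \<gamma>) + ln (cmod (1 + ?g * cis t))" for t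
    proof -
      have "1 + \<gamma> * cis t = \<gamma> * cis t * cnj (1 + ?g * cis t)"
        using g0 by (simp add: field_simps cis_cnj flip: cis_inverse)
      then have "cmod (1 + \<gamma> * cis t) = cmod \<gamma> * cmod (1 + ?g * cis t)"
        by (metis complex_mod_cnj mult.right_neutral norm_cis norm_mult)
      moreover have "1 + ?g * cis t \<noteq> 0"
        using g1 by (metis add_eq_0_iff less_irrefl mult.right_neutral norm_cis norm_minus_cancel norm_mult norm_one)
      ultimately show ?thesis using g0 by (simp add: ln_mult)
    qed
    show ?thesis
      unfolding eq using log_circle_inside[OF g1] 2
      by (simp add: integrable_angle_const integral_angle_const del: complex_cnj_inverse)
  next
    case 3
    \<comment> \<open>The functions \<open>log \<bar>1 + t \<gamma> w\<bar>\<close> need not be monotone in \<open>t\<close>, but they decrease as \<open>t \<rightarrow> 1\<close> after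
      subtraction of \<open>log t / 2\<close>, by the identity \<open>sq\<close> below; this correction tends to \<open>0\<close>.\<close>
    define t where "t n = 1 - 1 / (real n + 2)" for n
    have t: "0 < t n" "t n < 1" for n by (auto simp: t_def field_simps)
    have tmono: "t n \<le> t m" if "n \<le> m" for n m using that by (auto simp: t_def field_simps)
    have tlim: "t \<longlonglongrightarrow> 1" unfolding t_def by real_asymp
    have sq: "(cmod (1 + of_real s * \<gamma> * cis \<theta>))\<^sup>2 / s = (1 - s)\<^sup>2 / s + (cmod (1 + \<gamma> * cis \<theta>))\<^sup>2"
      if "0 < s" for s \<theta>
    proof -
      have "cmod (\<gamma> * cis \<theta>) = 1" using 3 by (simp add: norm_mult)
      then have u: "(Re (\<gamma> * cis \<theta>))\<^sup>2 + (Im (\<gamma> * cis \<theta>))\<^sup>2 = 1" by (metis cmod_power2 one_power2)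
      have "(cmod (1 + of_real s * (\<gamma> * cis \<theta>)))\<^sup>2 = (1 - s)\<^sup>2 + s * (cmod (1 + (\<gamma> * cis \<theta>)))\<^sup>2"
        unfolding cmod_power2 using u by (simp only: plus_complex.sel times_complex.sel one_complex.sel Re_complex_of_real Im_complex_of_real) algebra
      then show ?thesis using that by (simp add: field_simps)
    qed
    let ?v = "\<lambda>n \<theta>. 1/2 * ln (t n) - ln (cmod (1 + of_real (t n) * \<gamma> * cis \<theta>))"
    have nz: "1 + of_real (t n) * \<gamma> * cis \<theta> \<noteq> 0" for n \<theta>
    proof
      assume "1 + of_real (t n) * \<gamma> * cis \<theta> = 0"
      then have "of_real (t n) * \<gamma> * cis \<theta> = -1" by (simp add: add_eq_0_iff)
      then have "cmod (of_real (t n) * \<gamma> * cis \<theta>) = 1" by simp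
      then show False using t[of n] 3 by (simp add: norm_mult)
    qed
    have v: "?v n \<theta> = - 1/2 * ln ((cmod (1 + of_real (t n) * \<gamma> * cis \<theta>))\<^sup>2 / t n)" for n \<theta>
      using nz[of n \<theta>] t[of n] by (simp add: ln_div ln_realpow algebra_simps)
    have small: "cmod (of_real (t n) * \<gamma>) < 1" for n using t[of n] 3 by (simp add: norm_mult)
    have int: "integrable angle_measure (?v n)" for n
      using log_circle_inside(1)[OF small[of n]] by (intro Bochner_Integration.integrable_diff integrable_angle_const)
    have inte: "integral\<^sup>L angle_measure (?v n) = pi * ln (t n)" for n
      by (simp only: Bochner_Integration.integral_diff[OF integrable_angle_const log_circle_inside(1)[OF small]]
            integral_angle_const log_circle_inside(2)[OF small])
    have mono: "mono (\<lambda>n. ?v n \<theta>)" for \<theta>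
    proof (rule monoI)
      fix m n :: nat assume mn: "m \<le> n"
      have "(1 - t n)\<^sup>2 \<le> (1 - t m)\<^sup>2" using tmono[OF mn] t[of n] t[of m] by (intro power_mono) auto
      then have "(1 - t n)\<^sup>2 / t n \<le> (1 - t m)\<^sup>2 / t m" using tmono[OF mn] t by (intro frac_le) auto
      then have "(cmod (1 + of_real (t n) * \<gamma> * cis \<theta>))\<^sup>2 / t n \<le> (cmod (1 + of_real (t m) * \<gamma> * cis \<theta>))\<^sup>2 / t m"
        using sq[of "t n"] sq[of "t m"] t by simp
      moreover have "0 < (cmod (1 + of_real (t n) * \<gamma> * cis \<theta>))\<^sup>2 / t n" using nz t by simp
      ultimately show "?v m \<theta> \<le> ?v n \<theta>" unfolding v by simp
    qed
    have lim: "AE \<theta> in angle_measure. (\<lambda>n. ?v n \<theta>) \<longlonglongrightarrow> - ln (cmod (1 + \<gamma> * cis \<theta>))"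
      using AE_cis_neq[of "- inverse \<gamma>"]
    proof eventually_elim
      case (elim \<theta>)
      have "\<gamma> \<noteq> 0" using 3 by auto
      then have "1 + \<gamma> * cis \<theta> \<noteq> 0" using elim by (auto simp: field_simps add_eq_0_iff)
      then show ?case
        by (auto intro!: tendsto_eq_intros tlim)
    qed
    have ilim: "(\<lambda>n. integral\<^sup>L angle_measure (?v n)) \<longlonglongrightarrow> 0"
      unfolding inte by (auto intro!: tendsto_eq_intros tlim)
    have "(\<lambda>\<theta>. 1 + \<gamma> * cis \<theta>) \<in> borel_measurable borel"
      by (intro borel_measurable_continuous_onI continuous_intros)
    then have "(\<lambda>\<theta>. ln (cmod (1 + \<gamma> * cis \<theta>))) \<in> borel_measurable lborel" by measurable
    then have meas: "(\<lambda>\<theta>. ln (cmod (1 + \<gamma> * cis \<theta>))) \<in> borel_measurable angle_measure"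
      by (rule measurable_restrict_space1)
    from has_bochner_integral_monotone_convergence[OF int _ lim ilim]
    have "has_bochner_integral angle_measure (\<lambda>\<theta>. - ln (cmod (1 + \<gamma> * cis \<theta>))) 0" 
      using mono meas by auto
    then show ?thesis
      by (auto simp: has_bochner_integral_iff)
  qed
  then show ?A ?B by auto
qed

section \<open>The potential\<close>

text \<open>
  Here \<open>k \<ge> 1\<close>. The exponent pair \<open>(1 + 1/k, k + 1)\<close> lies on the hyperbola \<open>(x - 1) (y - 1) = 1\<close>. The
  constant \<open>(k + 1)\<^sup>2\<close> that is subtracted grows faster than \<open>(k + 1) log \<bar>w\<bar>\<close> for every fixed \<open>w\<close>, so that the
  supremum over \<open>k\<close> is less than \<open>\<infinity>\<close> also where \<open>\<bar>w\<bar> > 1\<close>. The case distinction gives \<open>log 0\<close> the value \<open>-\<infinity>\<close>,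
  where \<open>ln 0 = 0\<close>.
\<close>

definition toric_term :: "'n \<Rightarrow> 'n \<Rightarrow> nat \<Rightarrow> complex ^ 'n \<Rightarrow> ereal" where
  "toric_term p q k v =
     (if v $ p = 0 \<or> v $ q = 0 then - \<infinity>
      else ereal ((1 + 1 / real k) * ln (cmod (v $ p))
                  + (real k + 1) * (ln (cmod (v $ q)) - (real k + 1))))"

definition toric_potential :: "'n \<Rightarrow> 'n \<Rightarrow> complex ^ 'n \<Rightarrow> ereal" where
  "toric_potential p q v = (SUP k\<in>{1..}. toric_term p q k v)"

lemma toric_term_le_potential: "1 \<le> k \<Longrightarrow> toric_term p q k v \<le> toric_potential p q v"
  unfolding toric_potential_def by (rule SUP_upper) simp

text \<open>
  The mean on the right is that of a majorant \<open>u\<close>: taken with the supremum of all terms as \<open>u\<close>, the bound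
  has a right-hand side independent of \<open>k\<close>, and the submean inequality of the supremum follows.
\<close>

lemma toric_term_le_circle_mean:
  assumes le: "\<And>\<zeta>. toric_term p q k (a + \<zeta> *s b) \<le> u \<zeta>"
  shows "toric_term p q k (a + z *s b) \<le> circle_mean u z r"
proof (cases "(a + z *s b) $ p = 0 \<or> (a + z *s b) $ q = 0")
  case True
  then show ?thesis by (simp add: toric_term_def)
next
  case False
  define \<alpha> where "\<alpha> i = a $ i + z * b $ i" for i
  define \<gamma> where "\<gamma> i = of_real r * b $ i / \<alpha> i" for i
  have nz: "\<alpha> p \<noteq> 0" "\<alpha> q \<noteq> 0" using False by (auto simp: \<alpha>_def)
  let ?A = "1 + 1 / real k" and ?B = "real k + 1"
  have AB: "0 \<le> ?A" "0 \<le> ?B" by auto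
  let ?l = "\<lambda>i \<theta>. ln (cmod (1 + \<gamma> i * cis \<theta>))"
  let ?c = "?A * ln (cmod (\<alpha> p)) + ?B * (ln (cmod (\<alpha> q)) - ?B)"
  let ?v = "\<lambda>\<theta>. ?c + (?A * ?l p \<theta> + ?B * ?l q \<theta>)"
  have "ereal ?c \<le> circle_mean u z r"
  proof (rule circle_mean_ge)
    have ip: "integrable angle_measure (\<lambda>\<theta>. ?A * ?l p \<theta>)"
      and iq: "integrable angle_measure (\<lambda>\<theta>. ?B * ?l q \<theta>)"
      by (intro integrable_mult_right log_circle(1))+
    have int: "integrable angle_measure (\<lambda>\<theta>. ?A * ?l p \<theta> + ?B * ?l q \<theta>)"
      using ip iq by (rule Bochner_Integration.integrable_add)
    then show "integrable angle_measure ?v"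
      by (rule Bochner_Integration.integrable_add[OF integrable_angle_const])
    have "integral\<^sup>L angle_measure ?v = 2 * pi * ?c + (?A * integral\<^sup>L angle_measure (?l p) + ?B * integral\<^sup>L angle_measure (?l q))"
      by (simp only: Bochner_Integration.integral_add[OF integrable_angle_const int] integral_angle_const
            Bochner_Integration.integral_add[OF ip iq]
            integral_mult_right_zero)
    moreover have "0 \<le> ?A * integral\<^sup>L angle_measure (?l p) + ?B * integral\<^sup>L angle_measure (?l q)"
      by (intro add_nonneg_nonneg mult_nonneg_nonneg AB log_circle(2))
    ultimately show "2 * pi * ?c \<le> integral\<^sup>L angle_measure ?v" by linarith
    show "AE \<theta> in angle_measure. ereal (?v \<theta>) \<le> u (z + of_real r * cis \<theta>)"
      using AE_cis_neq[of "- inverse (\<gamma> p)"] AE_cis_neq[of "- inverse (\<gamma> q)"]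
    proof eventually_elim
      case (elim \<theta>)
      have nz': "1 + \<gamma> i * cis \<theta> \<noteq> 0" if "i \<in> {p, q}" for i
      proof
        assume "1 + \<gamma> i * cis \<theta> = 0"
        then have "cis \<theta> = - inverse (\<gamma> i)" by (cases "\<gamma> i = 0") (auto simp: field_simps add_eq_0_iff)
        with elim that show False by auto
      qed
      have prod: "(a + (z + of_real r * cis \<theta>) *s b) $ i = \<alpha> i * (1 + \<gamma> i * cis \<theta>)" if "i \<in> {p, q}" for i
        using nz that by (auto simp: \<gamma>_def \<alpha>_def field_simps)
      have "toric_term p q k (a + (z + of_real r * cis \<theta>) *s b) = ereal (?v \<theta>)"
        unfolding toric_term_def prod[of p, OF insertI1] prod[of q, OF insertI2[OF singletonI]] norm_mult
        using nz nz' by (subst if_not_P) (simp_all add: ln_mult, simp add: algebra_simps)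
      then show ?case using le by metis
    qed
  qed
  then show ?thesis using False by (simp add: toric_term_def \<alpha>_def)
qed

text \<open>
  After exponentiation the \<open>-\<infinity>\<close> case is no longer special: the power functions are continuous and vanish
  at \<open>0\<close>, so sublevel sets of a term are open.
\<close>

lemma toric_term_less_iff:
  "toric_term p q k v < ereal s \<longleftrightarrow>
     cmod (v $ p) powr (1 + 1 / real k) * cmod (v $ q) powr (real k + 1) < exp (s + (real k + 1)\<^sup>2)"
proof (cases "v $ p = 0 \<or> v $ q = 0")
  case True
  then show ?thesis by (auto simp: toric_term_def)
next
  case False
  then have "cmod (v $ p) powr (1 + 1 / real k) * cmod (v $ q) powr (real k + 1)
      = exp ((1 + 1 / real k) * ln (cmod (v $ p)) + (real k + 1) * ln (cmod (v $ q)))"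
    by (simp add: powr_def exp_add)
  then show ?thesis using False by (simp add: toric_term_def power2_eq_square algebra_simps)
qed

lemma open_toric_term_less: "open {v. toric_term p q k v < ereal s}"
  unfolding toric_term_less_iff
  by (intro open_Collect_less continuous_intros continuous_on_powr') (auto intro: add_pos_nonneg)

lemma toric_term_bound:
  assumes "1 \<le> k" "1 \<le> R" "cmod (v $ p) \<le> R" "cmod (v $ q) \<le> R"
  shows "toric_term p q k v \<le> ereal (2 * ln R + (real k + 1) * (ln R - (real k + 1)))"
proof (cases "v $ p = 0 \<or> v $ q = 0")
  case True
  then show ?thesis by (simp add: toric_term_def)
next
  case False
  then have l: "ln (cmod (v $ p)) \<le> ln R" "ln (cmod (v $ q)) \<le> ln R" using assms by auto
  have R: "0 \<le> ln R" using assms by simp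
  have "(1 + 1 / real k) * ln (cmod (v $ p)) \<le> (1 + 1 / real k) * ln R"
    using l by (intro mult_left_mono) auto
  also have "\<dots> \<le> 2 * ln R" using R assms(1) by (intro mult_right_mono) auto
  finally show ?thesis using False l by (auto simp: toric_term_def intro!: add_mono mult_left_mono)
qed

lemma toric_potential_bound:
  assumes "1 \<le> R" "cmod (v $ p) \<le> R" "cmod (v $ q) \<le> R"
  shows "toric_potential p q v \<le> ereal (2 * ln R + (ln R)\<^sup>2)"
  unfolding toric_potential_def
proof (rule SUP_least)
  fix k :: nat assume "k \<in> {1..}"
  then have "toric_term p q k v \<le> ereal (2 * ln R + (real k + 1) * (ln R - (real k + 1)))"
    using assms by (intro toric_term_bound) auto
  also have "(real k + 1) * (ln R - (real k + 1)) =
      (ln R)\<^sup>2 - ((ln R - (real k + 1) / 2)\<^sup>2 + 3 / 4 * (real k + 1)\<^sup>2)"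
    by (simp add: power2_eq_square field_simps)
  also have "\<dots> \<le> (ln R)\<^sup>2"
    using zero_le_power2[of "ln R - (real k + 1) / 2"] zero_le_power2[of "real k + 1"] by linarith
  finally show "toric_term p q k v \<le> ereal (2 * ln R + (ln R)\<^sup>2)" by simp
qed

lemma toric_potential_nonpos:
  assumes "v \<in> ball 0 1"
  shows "toric_potential p q v \<le> 0"
  using toric_potential_bound[of 1 v p q] Finite_Cartesian_Product.norm_nth_le[of v p]
    Finite_Cartesian_Product.norm_nth_le[of v q] assms
  by (simp add: zero_ereal_def)

lemma toric_potential_less_PInf: "toric_potential p q v < \<infinity>"
proof -
  have "cmod (v $ i) \<le> 1 + norm v" for i using Finite_Cartesian_Product.norm_nth_le[of v i] by linarith
  then show ?thesis using toric_potential_bound[of "1 + norm v" v p q] by (auto elim: le_less_trans)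
qed
 
text \<open>
  A supremum of infinitely many upper semicontinuous functions need not be upper semicontinuous. Here all
  but finitely many terms are, on a neighbourhood of the point, below any prescribed real number.
\<close>

lemma eventually_toric_potential_less:
  assumes "toric_potential p q v < t"
  shows "\<forall>\<^sub>F w in nhds v. toric_potential p q w < t"
proof -
  obtain s where s: "toric_potential p q v < ereal s" "ereal s < t" using ereal_dense2[OF assms] by blast
  define R where "R = norm v + 1"
  have "\<forall>\<^sub>F k in sequentially. 2 * ln R + (real k + 1) * (ln R - (real k + 1)) \<le> s"
    by real_asymp
  then obtain N where N: "\<And>k. N \<le> k \<Longrightarrow> 2 * ln R + (real k + 1) * (ln R - (real k + 1)) \<le> s"
    by (auto simp: eventually_sequentially)
  have "\<forall>\<^sub>F w in nhds v. \<forall>k\<in>{1..<N}. toric_term p q k w < ereal s"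
  proof (rule eventually_ball_finite)
    show "\<forall>k\<in>{1..<N}. \<forall>\<^sub>F w in nhds v. toric_term p q k w < ereal s"
    proof
      fix k assume "k \<in> {1..<N}"
      then have "toric_term p q k v < ereal s"
        using toric_term_le_potential[of k p q v] s(1) by (auto intro: le_less_trans)
      then show "\<forall>\<^sub>F w in nhds v. toric_term p q k w < ereal s"
        using eventually_nhds_in_open[OF open_toric_term_less, of v p q k s] by simp
    qed
  qed simp
  moreover have "\<forall>\<^sub>F w in nhds v. w \<in> ball v 1" by (rule eventually_nhds_in_open) auto
  ultimately show ?thesis
  proof eventually_elim
    case (elim w)
    have "norm w \<le> R" using elim(2) norm_triangle_sub[of w v] by (simp add: R_def dist_norm norm_minus_commute)
    then have wR: "cmod (w $ i) \<le> R" for i using Finite_Cartesian_Product.norm_nth_le[of w i] by linarith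
    have "toric_potential p q w \<le> ereal s"
      unfolding toric_potential_def
    proof (rule SUP_least)
      fix k :: nat assume k: "k \<in> {1..}"
      show "toric_term p q k w \<le> ereal s"
      proof (cases "k < N")
        case True
        then show ?thesis using elim(1) k by (simp add: less_imp_le)
      next
        case False
        have "toric_term p q k w \<le> ereal (2 * ln R + (real k + 1) * (ln R - (real k + 1)))"
          using k wR by (intro toric_term_bound) (auto simp: R_def)
        then show ?thesis using N[of k] False by (meson ereal_less_eq(3) leI order_trans)
      qed
    qed
    then show ?case using s(2) by (rule le_less_trans)
  qed
qed

text \<open>
  Restricted to a complex line, each term is a positive combination of logarithms of affine
  functions.
\<close>

lemma plurisubharmonic_toric_potential: "plurisubharmonic_on UNIV (toric_potential (p :: 'n :: finite) q)"
  unfolding plurisubharmonic_on_def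
proof (intro conjI ballI allI)
  show "upper_semicontinuous_on UNIV (toric_potential p q)"
    using eventually_toric_potential_less
    by (auto simp: upper_semicontinuous_on_def eventually_nhds_conv_at)
next
  fix a b :: "complex ^ 'n"
  have lim: "((\<lambda>\<zeta>. a + \<zeta> *s b) \<longlongrightarrow> a + z *s b) (nhds z)" for z
    unfolding vec_eq_iff by (rule vec_tendstoI) (auto intro!: tendsto_eq_intros filterlim_ident)
  have "subharmonic_on UNIV (\<lambda>\<zeta>. toric_potential p q (a + \<zeta> *s b))"
    unfolding subharmonic_on_def
  proof (intro conjI ballI allI impI)
    show "upper_semicontinuous_on UNIV (\<lambda>\<zeta>. toric_potential p q (a + \<zeta> *s b))"
      unfolding upper_semicontinuous_on_def
    proof (intro ballI allI impI)
      fix z t assume "toric_potential p q (a + z *s b) < t"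
      then have "\<forall>\<^sub>F w in nhds z. toric_potential p q (a + w *s b) < t"
        using eventually_compose_filterlim[OF eventually_toric_potential_less lim] by blast
      then show "\<forall>\<^sub>F w in at z. toric_potential p q (a + w *s b) < t"
        by (simp add: eventually_nhds_conv_at)
    qed
    show "toric_potential p q (a + z *s b) \<le> circle_mean (\<lambda>\<zeta>. toric_potential p q (a + \<zeta> *s b)) z r" for z r
    proof (subst toric_potential_def, rule SUP_least)
      fix k :: nat assume "k \<in> {1..}"
      then show "toric_term p q k (a + z *s b) \<le> circle_mean (\<lambda>\<zeta>. toric_potential p q (a + \<zeta> *s b)) z r"
        by (intro toric_term_le_circle_mean toric_term_le_potential) simp
    qed
  qed (simp add: toric_potential_less_PInf[simplified])
  then show "subharmonic_on {\<zeta>. a + \<zeta> *s b \<in> UNIV} (\<lambda>\<zeta>. toric_potential p q (a + \<zeta> *s b))"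
    by simp
next
  fix C :: "(complex ^ 'n) set" assume "C \<in> components UNIV"
  then have "C = UNIV" by (simp add: connected_UNIV connected_eq_components_subset_sing_exists components_eq_sing_iff) 
  moreover have "- \<infinity> < toric_term p q 1 1" by (simp add: toric_term_def)
  then have "- \<infinity> < toric_potential p q 1" using toric_term_le_potential[of 1 p q 1] by (auto elim: less_le_trans)
  ultimately show "\<exists>z\<in>C. toric_potential p q z \<noteq> - \<infinity>" by (auto intro!: bexI[of _ 1])
qed (auto simp: toric_potential_less_PInf[simplified])

section \<open>Monotonicity of multiplier ideals\<close>

lemma exp_ereal_mono: "s \<le> t \<Longrightarrow> exp_ereal s \<le> exp_ereal t"
  by (cases s; cases t) (auto simp: exp_ereal_def)

lemma weight_antimono:
  assumes "u \<le> u'"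
  shows "exp_ereal (- 2 * u') \<le> exp_ereal (- 2 * u)"
  using assms by (intro exp_ereal_mono, cases u; cases u') auto

lemma weight_ereal: "exp_ereal (- 2 * ereal t) = ennreal (exp (- 2 * t))"
  by (simp add: exp_ereal_def)

text \<open>
  Only germs matter, so a representative may be restricted to a neighbourhood where \<open>\<phi> \<le> 0\<close>, and there
  \<open>exp (- 2 c \<phi>)\<close> is nondecreasing in \<open>c\<close>.
\<close>

lemma multiplier_ideal_stalk_antimono:
  fixes \<phi> :: "complex ^ 'n \<Rightarrow> ereal"
  assumes "0 \<le> c" "c \<le> \<xi>" and W: "open W" "x \<in> W" and neg: "\<And>z. z \<in> W \<Longrightarrow> \<phi> z \<le> 0"
  shows "multiplier_ideal_stalk (\<lambda>z. ereal \<xi> * \<phi> z) x \<subseteq> multiplier_ideal_stalk (\<lambda>z. ereal c * \<phi> z) x"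
proof
  fix G assume "G \<in> multiplier_ideal_stalk (\<lambda>z. ereal \<xi> * \<phi> z) x"
  then obtain f U where G: "G = germ_at x f" and U: "open U" "x \<in> U"
    and f: "f \<in> multiplier_ideal_sections (\<lambda>z. ereal \<xi> * \<phi> z) U"
    unfolding multiplier_ideal_stalk_def by auto
  have le: "ereal \<xi> * \<phi> z \<le> ereal c * \<phi> z" if "z \<in> W" for z
    using neg[OF that] assms(1,2) by (cases "\<phi> z") (auto simp: mult_right_mono_neg)
  have "(\<integral>\<^sup>+z\<in>K. ennreal ((cmod (f z))\<^sup>2) * exp_ereal (- 2 * (ereal c * \<phi> z)) \<partial>lborel) < \<infinity>"
    if K: "compact K" "K \<subseteq> U \<inter> W" for K
  proof -
    have "(\<integral>\<^sup>+z\<in>K. ennreal ((cmod (f z))\<^sup>2) * exp_ereal (- 2 * (ereal c * \<phi> z)) \<partial>lborel)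
        \<le> (\<integral>\<^sup>+z\<in>K. ennreal ((cmod (f z))\<^sup>2) * exp_ereal (- 2 * (ereal \<xi> * \<phi> z)) \<partial>lborel)"
    proof (rule nn_integral_mono)
      fix z :: "complex ^ 'n"
      show "ennreal ((cmod (f z))\<^sup>2) * exp_ereal (- 2 * (ereal c * \<phi> z)) * indicator K z
          \<le> ennreal ((cmod (f z))\<^sup>2) * exp_ereal (- 2 * (ereal \<xi> * \<phi> z)) * indicator K z"
      proof (cases "z \<in> K")
        case True
        then have "z \<in> W" using K by blast
        then show ?thesis by (intro mult_right_mono mult_left_mono weight_antimono le) simp_all
      qed simp
    qed
    also have "\<dots> < \<infinity>" using f K by (auto simp: multiplier_ideal_sections_def)
    finally show ?thesis .
  qed
  then have "f \<in> multiplier_ideal_sections (\<lambda>z. ereal c * \<phi> z) (U \<inter> W)"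
    using f by (auto simp: multiplier_ideal_sections_def holomorphic_several_on_def)
  then show "G \<in> multiplier_ideal_stalk (\<lambda>z. ereal c * \<phi> z) x"
    unfolding multiplier_ideal_stalk_def G using U W by blast
qed

section \<open>Divergence at the critical exponent\<close>

lemma prod_Basis_complex_vec:
  fixes f :: "complex ^ 'n \<Rightarrow> 'a :: comm_monoid_mult"
  shows "(\<Prod>b\<in>Basis. f b) = (\<Prod>i\<in>UNIV. f (axis i 1) * f (axis i \<i>))"
proof -
  have B: "(Basis :: (complex ^ 'n) set) = (\<Union>i\<in>UNIV. {axis i 1, axis i \<i>})"
    by (auto simp: Basis_vec_def Basis_complex_def)
  have "(\<Prod>b\<in>Basis. f b) = (\<Prod>i\<in>UNIV. \<Prod>b\<in>{axis i 1, axis i \<i>}. f b)"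
    unfolding B by (rule prod.UNION_disjoint) (auto simp: axis_eq_axis)
  also have "\<dots> = (\<Prod>i\<in>UNIV. f (axis i 1) * f (axis i \<i>))"
    by (intro prod.cong refl) (auto simp: axis_eq_axis)
  finally show ?thesis .
qed

text \<open>
  A box inside the polydisc with radii \<open>\<rho>\<close> on which all \<open>\<bar>x\<^sub>i\<bar>\<close> are comparable to \<open>\<rho>\<^sub>i\<close>. Boxes are used instead
  of products of annuli because their volume is immediate.
\<close>

definition corner_box :: "('n \<Rightarrow> real) \<Rightarrow> (complex ^ 'n) set" where
  "corner_box \<rho> = cbox (\<chi> i. Complex (\<rho> i / 4) (\<rho> i / 4)) (\<chi> i. Complex (\<rho> i / 2) (\<rho> i / 2))"

lemma mem_corner_box:
  "x \<in> corner_box \<rho> \<longleftrightarrow>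
     (\<forall>i. \<rho> i / 4 \<le> Re (x $ i) \<and> Re (x $ i) \<le> \<rho> i / 2 \<and> \<rho> i / 4 \<le> Im (x $ i) \<and> Im (x $ i) \<le> \<rho> i / 2)"
  by (auto simp: corner_box_def mem_box Basis_vec_def Basis_complex_def inner_axis)

lemma cmod_corner_box:
  assumes "x \<in> corner_box \<rho>"
  shows "\<rho> i / 4 \<le> cmod (x $ i)" "cmod (x $ i) \<le> \<rho> i"
proof -
  have b: "\<rho> i / 4 \<le> Re (x $ i)" "Re (x $ i) \<le> \<rho> i / 2" "\<rho> i / 4 \<le> Im (x $ i)" "Im (x $ i) \<le> \<rho> i / 2"
    using assms by (auto simp: mem_corner_box)
  show "\<rho> i / 4 \<le> cmod (x $ i)" using b(1) complex_Re_le_cmod[of "x $ i"] by linarith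
  show "cmod (x $ i) \<le> \<rho> i" using cmod_le[of "x $ i"] b by linarith
qed

lemma emeasure_corner_box:
  assumes "\<And>i. 0 \<le> \<rho> i"
  shows "emeasure lborel (corner_box \<rho>) = ennreal (\<Prod>i\<in>UNIV. (\<rho> i / 4)\<^sup>2)"
proof -
  have "emeasure lborel (corner_box \<rho>) =
      ennreal (\<Prod>b\<in>Basis. ((\<chi> i. Complex (\<rho> i / 2) (\<rho> i / 2)) - (\<chi> i. Complex (\<rho> i / 4) (\<rho> i / 4))) \<bullet> b)"
    unfolding corner_box_def using assms
    by (intro emeasure_lborel_cbox) (auto simp: Basis_vec_def Basis_complex_def inner_axis)
  then show ?thesis
    unfolding prod_Basis_complex_vec by (simp add: inner_axis power2_eq_square)
qed

text \<open>
  On the ray \<open>log \<bar>z\<bar> = - s k\<^sup>2\<close>, \<open>log \<bar>w\<bar> = - s\<close> the linear part of the \<open>k\<close>-th term dominates the other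
  ones: \<open>(k\<^sup>2, 1)\<close> is normal to the hyperbola \<open>(x - 1) (y - 1) = 1\<close> at \<open>(1 + 1/k, k + 1)\<close>. In formulas,
  \<open>k\<^sup>2/j + j - 2 k = (k - j)\<^sup>2/j \<ge> 0\<close>. The bound on the ray holds in the whole polydisc below it, because
  every term increases with \<open>\<bar>z\<bar>\<close> and \<open>\<bar>w\<bar>\<close>.
\<close>

lemma toric_potential_le_near_ray:
  assumes k: "1 \<le> k" and s: "0 \<le> s"
    and v: "cmod (v $ p) \<le> exp (- s * (real k)\<^sup>2)" "cmod (v $ q) \<le> exp (- s)"
  shows "toric_potential p q v \<le> ereal (- s * (real k + 1)\<^sup>2)"
  unfolding toric_potential_def
proof (rule SUP_least)
  fix j :: nat assume "j \<in> {1..}"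
  then have j: "1 \<le> real j" by simp
  show "toric_term p q j v \<le> ereal (- s * (real k + 1)\<^sup>2)"
  proof (cases "v $ p = 0 \<or> v $ q = 0")
    case True
    then show ?thesis by (simp add: toric_term_def)
  next
    case False
    have "ln y \<le> t" if "y \<le> exp t" "0 < y" for y t :: real
      using that by (metis exp_ln exp_le_cancel_iff)
    then have l: "ln (cmod (v $ p)) \<le> - s * (real k)\<^sup>2" "ln (cmod (v $ q)) \<le> - s"
      using v False by simp_all
    have "(1 + 1 / real j) * ln (cmod (v $ p)) + (real j + 1) * (ln (cmod (v $ q)) - (real j + 1))
        \<le> (1 + 1 / real j) * (- s * (real k)\<^sup>2) + (real j + 1) * (- s)"
      using l j by (intro add_mono mult_left_mono) auto
    also have "\<dots> = - s * (real k + 1)\<^sup>2 - s * ((real k - real j)\<^sup>2 / real j)"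
      using j by (simp add: power2_eq_square field_simps)
    also have "\<dots> \<le> - s * (real k + 1)\<^sup>2" using s j by simp
    finally show ?thesis using False by (simp add: toric_term_def)
  qed
qed

text \<open>
  The boxes with radii \<open>\<delta> exp (- r k\<^sup>2)\<close>, \<open>\<delta> exp (- r)\<close> in the coordinates \<open>z\<close>, \<open>w\<close> and \<open>\<delta>\<close> in the others, for
  \<open>r = 0, 1, 2, \<dots>\<close>, are disjoint and follow the ray above towards the singularity. Up to a constant factor
  independent of \<open>r\<close>, the volume of a box is \<open>exp (- 2 r (k\<^sup>2 + 1))\<close>, the square of the monomial is at least
  \<open>exp (- 2 r (k - 1))\<close> on it, and the weight is at least \<open>exp (2 r k (k + 1))\<close>. The exponents add up to \<open>0\<close>:
  every box contributes at least the same positive amount.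
\<close>

lemma monomial_not_integrable:
  fixes p q :: "'n :: finite"
  assumes pq: "p \<noteq> q" and k: "1 \<le> k" and \<epsilon>: "0 < \<epsilon>"
  shows "(\<integral>\<^sup>+z\<in>cball 0 \<epsilon>. ennreal ((cmod ((z $ q) ^ (k - 1)))\<^sup>2)
            * exp_ereal (- 2 * (ereal (real k / (real k + 1)) * toric_potential p q z)) \<partial>lborel) = \<infinity>"
    (is "?I = \<infinity>")
proof -
  define \<delta> where "\<delta> = min 1 (\<epsilon> / CARD('n))"
  have \<delta>: "0 < \<delta>" "\<delta> \<le> 1" "CARD('n) * \<delta> \<le> \<epsilon>"
    using \<epsilon> by (auto simp: \<delta>_def min_def field_simps)
  define s where "s i = (if i = p then (real k)\<^sup>2 else if i = q then 1 else 0)" for i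
  define \<rho> where "\<rho> r i = \<delta> * exp (- real r * s i)" for r i
  have s0: "0 \<le> s i" for i by (simp add: s_def)
  have sum_s: "sum s UNIV = (real k)\<^sup>2 + 1"
  proof -
    have "sum s UNIV = sum s {p, q}" by (rule sum.mono_neutral_right) (auto simp: s_def)
    then show ?thesis using pq by (simp add: s_def)
  qed
  have \<rho>: "0 < \<rho> r i" "\<rho> r i \<le> \<delta>" "\<rho> r i \<le> exp (- real r * s i)" for r i
    using \<delta> s0[of i] by (auto simp: \<rho>_def mult_le_cancel_left1 mult_le_cancel_right1)
  let ?B = "\<lambda>r. corner_box (\<rho> r)"
  let ?m = "\<lambda>r. (\<delta> / 4) ^ (2 * (k - 1)) * exp (2 * real r * (real k)\<^sup>2 + 2 * real r)"
  let ?g = "\<lambda>z. ennreal ((cmod ((z $ q) ^ (k - 1)))\<^sup>2)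
            * exp_ereal (- 2 * (ereal (real k / (real k + 1)) * toric_potential p q z))"
  have disj: "disjoint_family ?B"
  proof -
    have "?B r \<inter> ?B t = {}" if "r < t" for r t
    proof (rule ccontr)
      assume "?B r \<inter> ?B t \<noteq> {}"
      then have "\<rho> r q / 4 \<le> \<rho> t q / 2" by (auto simp: mem_corner_box dest!: spec[of _ q])
      then have "exp (- real r) \<le> 2 * exp (- real t)" using \<delta> pq by (simp add: \<rho>_def s_def)
      also have "2 * exp (- real t) < exp 1 * exp (- real t)" using exp_lower_Taylor_quadratic[of 1] by simp
      also have "exp 1 * exp (- real t) = exp (1 - real t)" by (simp flip: exp_add)
      also have "\<dots> \<le> exp (- real r)" using that by simp
      finally show False by simp
    qed
    then show ?thesis
      unfolding disjoint_family_on_def by (metis Int_commute linorder_neqE_nat)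
  qed
  have sub: "?B r \<subseteq> cball 0 \<epsilon>" for r
  proof
    fix x assume x: "x \<in> ?B r"
    have "norm x \<le> (\<Sum>i\<in>UNIV. cmod (x $ i))" by (simp add: norm_vec_def L2_set_le_sum)
    also have "\<dots> \<le> (\<Sum>i\<in>(UNIV :: 'n set). \<delta>)"
      using cmod_corner_box(2)[OF x] \<rho>(2) order_trans by (intro sum_mono) blast
    also have "\<dots> \<le> \<epsilon>" using \<delta> by simp
    finally show "x \<in> cball 0 \<epsilon>" by simp
  qed
  have lower: "ennreal (?m r) \<le> ?g x" if x: "x \<in> ?B r" for r x
  proof -
    have "toric_potential p q x \<le> ereal (- real r * (real k + 1)\<^sup>2)"
      using cmod_corner_box(2)[OF x] \<rho>(3)[of r p] \<rho>(3)[of r q] pq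
      by (intro toric_potential_le_near_ray k) (auto simp: s_def intro: order_trans)
    then have "ereal (real k / (real k + 1)) * toric_potential p q x
        \<le> ereal (real k / (real k + 1)) * ereal (- real r * (real k + 1)\<^sup>2)"
      by (rule ereal_mult_left_mono) simp
    also have "\<dots> = ereal (- real r * real k * (real k + 1))"
      by (simp add: power2_eq_square field_simps)
    finally have e: "ennreal (exp (- 2 * (- real r * real k * (real k + 1))))
        \<le> exp_ereal (- 2 * (ereal (real k / (real k + 1)) * toric_potential p q x))"
      unfolding weight_ereal[symmetric] by (rule weight_antimono)
    have "(\<rho> r q / 4) ^ (2 * (k - 1)) \<le> cmod (x $ q) ^ (2 * (k - 1))"
      using cmod_corner_box(1)[OF x, of q] \<rho>(1)[of r q] by (intro power_mono) auto
    also have "\<dots> = (cmod ((x $ q) ^ (k - 1)))\<^sup>2" by (simp add: norm_power mult.commute flip: power_mult)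
    finally have w: "(\<rho> r q / 4) ^ (2 * (k - 1)) \<le> (cmod ((x $ q) ^ (k - 1)))\<^sup>2" .
    have "(\<rho> r q / 4) ^ (2 * (k - 1)) = (\<delta> / 4) ^ (2 * (k - 1)) * exp (- real r) ^ (2 * (k - 1))"
      using pq by (simp add: \<rho>_def s_def power_mult_distrib power_divide)
    also have "exp (- real r) ^ (2 * (k - 1)) = exp (- (2 * real r * (real k - 1)))"
      using k by (simp add: of_nat_diff flip: exp_of_nat_mult)
    finally have "?m r = (\<rho> r q / 4) ^ (2 * (k - 1)) * exp (- 2 * (- real r * real k * (real k + 1)))"
      by (simp add: mult.assoc power2_eq_square algebra_simps flip: exp_add)
    then have "ennreal (?m r) = ennreal ((\<rho> r q / 4) ^ (2 * (k - 1))) * ennreal (exp (- 2 * (- real r * real k * (real k + 1))))"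
      using \<rho>(1)[of r q] by (simp add: ennreal_mult)
    also have "\<dots> \<le> ?g x" using w e by (intro mult_mono ennreal_leI) auto
    finally show ?thesis .
  qed
  have vol: "ennreal (?m r) * emeasure lborel (?B r) = ennreal ((\<delta> / 4) ^ (2 * (k - 1)) * (\<delta> / 4) ^ (2 * CARD('n)))" for r
  proof -
    have "(\<Prod>i\<in>UNIV. (\<rho> r i / 4)\<^sup>2) = (\<Prod>i\<in>(UNIV :: 'n set). (\<delta> / 4)\<^sup>2 * exp (- 2 * real r * s i))"
      by (intro prod.cong refl) (simp add: \<rho>_def power2_eq_square field_simps flip: exp_add)
    also have "\<dots> = (\<delta> / 4) ^ (2 * CARD('n)) * exp (- 2 * real r * ((real k)\<^sup>2 + 1))"
    proof -
      have "(\<Prod>i\<in>UNIV. exp (- 2 * real r * s i)) = exp (\<Sum>i\<in>UNIV. - 2 * real r * s i)"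
        by (simp only: exp_sum finite)
      also have "\<dots> = exp (- 2 * real r * ((real k)\<^sup>2 + 1))"
        by (simp only: sum_s flip: sum_distrib_left)
      finally show ?thesis by (simp add: prod.distrib power_mult)
    qed
    finally have "?m r * (\<Prod>i\<in>UNIV. (\<rho> r i / 4)\<^sup>2) =
        (\<delta> / 4) ^ (2 * (k - 1)) * (\<delta> / 4) ^ (2 * CARD('n))
          * (exp (2 * real r * (real k)\<^sup>2 + 2 * real r) * exp (- 2 * real r * ((real k)\<^sup>2 + 1)))"
      by (simp only: mult_ac)
    also have "exp (2 * real r * (real k)\<^sup>2 + 2 * real r) * exp (- 2 * real r * ((real k)\<^sup>2 + 1)) = 1"
      by (simp add: algebra_simps flip: exp_add)
    finally show ?thesis
      using \<rho>(1) by (simp add: emeasure_corner_box less_imp_le prod_nonneg flip: ennreal_mult)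
  qed
  have meas [measurable]: "?B r \<in> sets lborel" for r by (simp add: corner_box_def)
  have "\<infinity> = (\<Sum>r. ennreal ((\<delta> / 4) ^ (2 * (k - 1)) * (\<delta> / 4) ^ (2 * CARD('n))))"
    using \<delta> by (subst nn_integral_count_space_nat[symmetric]) (simp add: ennreal_mult_top)
  also have "\<dots> = (\<Sum>r. \<integral>\<^sup>+x. ennreal (?m r) * indicator (?B r) x \<partial>lborel)"
    by (simp only: nn_integral_cmult_indicator[OF meas] vol)
  also have "\<dots> = (\<integral>\<^sup>+x. (\<Sum>r. ennreal (?m r) * indicator (?B r) x) \<partial>lborel)"
    using meas by (intro nn_integral_suminf[symmetric]) measurable
  also have "\<dots> \<le> ?I"
  proof (rule nn_integral_mono)
    fix x :: "complex ^ 'n"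
    show "(\<Sum>r. ennreal (?m r) * indicator (?B r) x) \<le> ?g x * indicator (cball 0 \<epsilon>) x"
    proof (cases "\<exists>r. x \<in> ?B r")
      case True
      then obtain r where r: "x \<in> ?B r" by blast
      have "(\<Sum>r. ennreal (?m r) * indicator (?B r) x) = ennreal (?m r)"
        by (rule suminf_cmult_indicator[OF disj r])
      then show ?thesis using lower[OF r] sub[of r] r by (auto simp: indicator_def)
    next
      case False
      then show ?thesis by (simp add: indicator_def)
    qed
  qed
  finally show ?thesis by (simp add: top.extremum_unique)
qed

section \<open>Convergence below the critical exponent\<close>

lemma nn_integral_abs_powr:
  assumes "\<theta> < 1"
  shows "(\<integral>\<^sup>+t. ennreal (\<bar>t\<bar> powr - \<theta>) * indicator {-1..1} t \<partial>lborel) < \<infinity>"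
proof -
  have "((\<lambda>t. t powr - \<theta>) has_integral (1 powr (- \<theta> + 1) / (- \<theta> + 1))) {0..1}"
    using assms by (intro has_integral_powr_from_0) auto
  then have pos: "((\<lambda>t. \<bar>t\<bar> powr - \<theta>) has_integral (1 / (1 - \<theta>))) {0..1}"
    by (auto elim!: has_integral_eq[rotated])
  then have "((\<lambda>t. \<bar>- t\<bar> powr - \<theta>) has_integral (1 / (1 - \<theta>))) {-1..-0}"
    by (subst has_integral_reflect_real)
  then have neg: "((\<lambda>t. \<bar>t\<bar> powr - \<theta>) has_integral (1 / (1 - \<theta>))) {-1..0}" by simp
  have "((\<lambda>t. \<bar>t\<bar> powr - \<theta>) has_integral (1 / (1 - \<theta>) + 1 / (1 - \<theta>))) {-1..1}"
    by (rule has_integral_combine[OF _ _ neg pos]) auto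
  then show ?thesis by (subst nn_integral_has_integral_lebesgue') auto
qed

lemma nn_integral_prod_abs_powr:
  assumes "\<theta> < 1"
  shows "(\<integral>\<^sup>+x. (\<Prod>b\<in>Basis. ennreal (\<bar>x \<bullet> b\<bar> powr - \<theta>) * indicator {-1..1} (x \<bullet> b))
           \<partial>(lborel :: 'a :: euclidean_space measure)) < \<infinity>"
  using nn_integral_abs_powr[OF assms]
  by (subst nn_integral_lborel_prod) (auto simp: power_less_top_ennreal)

text \<open>
  This turns a power of \<open>\<bar>z\<bar>\<close> into a product over real coordinates, whose integral over a cube is a product
  of one-dimensional integrals.
\<close>

lemma cmod_powr_le:
  assumes "Re z \<noteq> 0" "Im z \<noteq> 0" "0 \<le> \<theta>"
  shows "cmod z powr (- 2 * \<theta>) \<le> \<bar>Re z\<bar> powr - \<theta> * \<bar>Im z\<bar> powr - \<theta>"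
proof -
  have "0 \<le> (\<bar>Re z\<bar> - \<bar>Im z\<bar>)\<^sup>2" by simp
  then have "2 * (\<bar>Re z\<bar> * \<bar>Im z\<bar>) \<le> (cmod z)\<^sup>2"
    unfolding cmod_power2 by (simp add: power2_diff)
  moreover have "0 \<le> \<bar>Re z\<bar> * \<bar>Im z\<bar>" by simp
  ultimately have le: "\<bar>Re z\<bar> * \<bar>Im z\<bar> \<le> (cmod z)\<^sup>2" by linarith
  have "cmod z powr (- 2 * \<theta>) = ((cmod z)\<^sup>2) powr - \<theta>"
    using assms by (simp add: powr_powr flip: powr_numeral)
  also have "\<dots> \<le> (\<bar>Re z\<bar> * \<bar>Im z\<bar>) powr - \<theta>"
    using assms le by (intro powr_mono2') auto
  also have "\<dots> = \<bar>Re z\<bar> powr - \<theta> * \<bar>Im z\<bar> powr - \<theta>" by (simp add: powr_mult)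
  finally show ?thesis .
qed

text \<open>
  With \<open>\<theta> = c (k + 1) / k\<close>, the \<open>k\<close>-th term alone bounds the weight by a multiple of
  \<open>\<bar>z\<bar> powr (- 2 \<theta>) * \<bar>w\<bar> powr (- 2 \<theta> k)\<close>. The monomial \<open>w ^ (k - 1)\<close> improves the exponent of \<open>\<bar>w\<bar>\<close> to
  \<open>2 (k - 1) - 2 \<theta> k = - 2 \<theta> + 2 (k - 1) (1 - \<theta>) \<ge> - 2 \<theta>\<close>.
\<close>

lemma monomial_weight_le:
  fixes p q :: "'n :: finite"
  assumes pq: "p \<noteq> q" and k: "1 \<le> k" and c: "0 \<le> c" and \<theta>: "\<theta> = c * (1 + 1 / real k)" "\<theta> \<le> 1"
    and x: "norm x \<le> 1" "\<And>b. b \<in> Basis \<Longrightarrow> x \<bullet> b \<noteq> 0"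
  shows "ennreal ((cmod ((x $ q) ^ (k - 1)))\<^sup>2) * exp_ereal (- 2 * (ereal c * toric_potential p q x))
    \<le> ennreal (exp (2 * c * (real k + 1)\<^sup>2))
        * (\<Prod>b\<in>Basis. ennreal (\<bar>x \<bullet> b\<bar> powr - \<theta>) * indicator {-1..1} (x \<bullet> b))"
proof -
  have nz: "Re (x $ i) \<noteq> 0" "Im (x $ i) \<noteq> 0" for i
    using x(2)[of "axis i 1"] x(2)[of "axis i \<i>"]
    by (auto simp: Basis_vec_def Basis_complex_def inner_axis)
  then have nz': "x $ i \<noteq> 0" for i by (metis zero_complex.sel(1))
  have le1: "cmod (x $ i) \<le> 1" for i using Finite_Cartesian_Product.norm_nth_le[of x i] x(1) by linarith
  have \<theta>0: "0 \<le> \<theta>" using c \<theta> by simp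
  let ?lz = "ln (cmod (x $ p))" and ?lw = "ln (cmod (x $ q))"
  let ?t = "(1 + 1 / real k) * ?lz + (real k + 1) * (?lw - (real k + 1))"
  have "ereal c * ereal ?t \<le> ereal c * toric_potential p q x"
    using toric_term_le_potential[OF k, of p q x] c nz' by (intro ereal_mult_left_mono) (auto simp: toric_term_def)
  then have "exp_ereal (- 2 * (ereal c * toric_potential p q x)) \<le> exp_ereal (- 2 * (ereal c * ereal ?t))"
    by (rule weight_antimono)
  also have "\<dots> = ennreal (exp (- 2 * (c * ?t)))" by (simp only: times_ereal.simps weight_ereal)
  finally have "ennreal ((cmod ((x $ q) ^ (k - 1)))\<^sup>2) * exp_ereal (- 2 * (ereal c * toric_potential p q x))
      \<le> ennreal ((cmod ((x $ q) ^ (k - 1)))\<^sup>2) * ennreal (exp (- 2 * (c * ?t)))"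
    by (rule mult_left_mono) simp
  also have "\<dots> = ennreal ((cmod ((x $ q) ^ (k - 1)))\<^sup>2 * exp (- 2 * (c * ?t)))" by (simp add: ennreal_mult)
  also have "\<dots> \<le> ennreal (exp (2 * c * (real k + 1)\<^sup>2) * (\<Prod>b\<in>Basis. \<bar>x \<bullet> b\<bar> powr - \<theta>))"
  proof (rule ennreal_leI)
    have "(cmod ((x $ q) ^ (k - 1)))\<^sup>2 = exp ?lw ^ (2 * (k - 1))"
      using nz' by (simp add: norm_power mult.commute flip: power_mult)
    also have "\<dots> = exp (2 * (real k - 1) * ?lw)" using k by (simp add: of_nat_diff flip: exp_of_nat_mult)
    finally have w: "(cmod ((x $ q) ^ (k - 1)))\<^sup>2 = exp (2 * (real k - 1) * ?lw)" .
    have "(cmod ((x $ q) ^ (k - 1)))\<^sup>2 * exp (- 2 * (c * ?t)) = exp (2 * (real k - 1) * ?lw - 2 * (c * ?t))"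
      by (simp only: w mult_exp_exp) simp
    also have "\<dots> \<le> exp (2 * c * (real k + 1)\<^sup>2 + (- 2 * \<theta> * ?lz + - 2 * \<theta> * ?lw))"
    proof -
      have ck: "c * (real k + 1) = \<theta> * real k" using \<theta> k by (simp add: field_simps)
      have "c * ?t = \<theta> * ?lz + (c * (real k + 1)) * ?lw - c * (real k + 1)\<^sup>2"
        unfolding \<theta>(1) by (simp add: algebra_simps power2_eq_square)
      then have ct: "c * ?t = \<theta> * ?lz + \<theta> * real k * ?lw - c * (real k + 1)\<^sup>2" unfolding ck .
      have "2 * (real k - 1) * ?lw - 2 * (\<theta> * ?lz + \<theta> * real k * ?lw - c * (real k + 1)\<^sup>2)
          = 2 * c * (real k + 1)\<^sup>2 + (- 2 * \<theta> * ?lz + - 2 * \<theta> * ?lw) + 2 * ((real k - 1) * (1 - \<theta>) * ?lw)"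
        by (simp add: algebra_simps)
      moreover have "(real k - 1) * (1 - \<theta>) * ?lw \<le> 0"
        using k \<theta>(2) le1[of q] nz'[of q] by (intro mult_nonneg_nonpos mult_nonneg_nonneg) auto
      ultimately show ?thesis unfolding exp_le_cancel_iff ct by linarith
    qed
    also have "\<dots> = exp (2 * c * (real k + 1)\<^sup>2) * (\<Prod>i\<in>{p, q}. cmod (x $ i) powr (- 2 * \<theta>))"
      using pq nz' by (simp add: powr_def mult_exp_exp)
    \<comment> \<open>The factors for the other coordinates are at least \<open>1\<close>; with them the bound is a product over all
      of \<open>Basis\<close>.\<close>
    also have "(\<Prod>i\<in>{p, q}. cmod (x $ i) powr (- 2 * \<theta>)) \<le> (\<Prod>i\<in>UNIV. cmod (x $ i) powr (- 2 * \<theta>))"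
    proof (rule prod_mono2)
      show "1 \<le> cmod (x $ i) powr (- 2 * \<theta>)" for i
        using powr_mono2'[of "- 2 * \<theta>" "cmod (x $ i)" 1] \<theta>0 nz'[of i] le1[of i] by simp
    qed auto
    also have "\<dots> \<le> (\<Prod>i\<in>UNIV. \<bar>Re (x $ i)\<bar> powr - \<theta> * \<bar>Im (x $ i)\<bar> powr - \<theta>)"
      using nz \<theta>0 by (intro prod_mono conjI cmod_powr_le) auto
    also have "\<dots> = (\<Prod>b\<in>Basis. \<bar>x \<bullet> b\<bar> powr - \<theta>)"
      by (simp add: prod_Basis_complex_vec inner_axis)
    finally show "(cmod ((x $ q) ^ (k - 1)))\<^sup>2 * exp (- 2 * (c * ?t))
      \<le> exp (2 * c * (real k + 1)\<^sup>2) * (\<Prod>b\<in>Basis. \<bar>x \<bullet> b\<bar> powr - \<theta>)" by simp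
  qed
  also have "\<dots> = ennreal (exp (2 * c * (real k + 1)\<^sup>2)) * (\<Prod>b\<in>Basis. ennreal (\<bar>x \<bullet> b\<bar> powr - \<theta>))"
    by (simp add: ennreal_mult prod_nonneg prod_ennreal)
  also have "(\<Prod>b\<in>Basis. ennreal (\<bar>x \<bullet> b\<bar> powr - \<theta>)) =
      (\<Prod>b\<in>Basis. ennreal (\<bar>x \<bullet> b\<bar> powr - \<theta>) * indicator {-1..1} (x \<bullet> b))"
    using x(1) Basis_le_norm[of _ x] by (intro prod.cong refl) (force simp: indicator_def abs_le_iff)
  finally show ?thesis .
qed

section \<open>Jumping coefficients\<close>

lemma monomial_in_stalk:
  fixes p q :: "'n :: finite"
  assumes pq: "p \<noteq> q" and k: "1 \<le> k" and c: "0 \<le> c" "c < real k / (real k + 1)"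
  shows "germ_at 0 (\<lambda>z. (z $ q) ^ (k - 1)) \<in> multiplier_ideal_stalk (\<lambda>z. ereal c * toric_potential p q z) 0"
proof -
  let ?f = "\<lambda>z :: complex ^ 'n. (z $ q) ^ (k - 1)"
  define \<theta> where "\<theta> = c * (1 + 1 / real k)"
  have \<theta>: "\<theta> < 1" using c k by (simp add: \<theta>_def field_simps)
  let ?G = "\<lambda>x :: complex ^ 'n. \<Prod>b\<in>Basis. ennreal (\<bar>x \<bullet> b\<bar> powr - \<theta>) * indicator {-1..1} (x \<bullet> b)"
  have "?f \<in> multiplier_ideal_sections (\<lambda>z. ereal c * toric_potential p q z) (ball 0 1)"
    unfolding multiplier_ideal_sections_def
  proof (intro CollectI conjI allI impI)
    show "holomorphic_several_on ?f (ball 0 1)"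
      unfolding holomorphic_several_on_def
    proof
      fix z :: "complex ^ 'n"
      have "(?f has_derivative (\<lambda>y. of_nat (k - 1) * (y $ q) * (z $ q) ^ (k - 1 - 1))) (at z)"
        by (intro has_derivative_power bounded_linear_imp_has_derivative bounded_linear_vec_nth)
      then show "\<exists>D. (?f has_derivative D) (at z) \<and> (\<forall>c v. D (c *s v) = c * D v)"
        by (intro exI[of _ "\<lambda>y. of_nat (k - 1) * (y $ q) * (z $ q) ^ (k - 1 - 1)"] conjI) (simp_all add: mult_ac)
    qed
    fix K :: "(complex ^ 'n) set" assume K: "compact K \<and> K \<subseteq> ball 0 1"
    have "AE x in (lborel :: (complex ^ 'n) measure). \<forall>b\<in>Basis. x \<bullet> b \<noteq> 0"
      by (rule AE_ball_countable[THEN iffD2]) (auto simp: AE_lborel_inner_neq countable_finite)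
    then have "(\<integral>\<^sup>+z\<in>K. ennreal ((cmod (?f z))\<^sup>2) * exp_ereal (- 2 * (ereal c * toric_potential p q z)) \<partial>lborel)
        \<le> (\<integral>\<^sup>+x. ennreal (exp (2 * c * (real k + 1)\<^sup>2)) * ?G x \<partial>lborel)"
    proof (intro nn_integral_mono_AE, eventually_elim)
      case (elim x)
      show ?case
      proof (cases "x \<in> K")
        case True
        then show ?thesis
          using monomial_weight_le[OF pq k c(1) \<theta>_def, of x] K \<theta> elim by (force simp: subset_iff)
      qed simp
    qed
    also have "\<dots> = ennreal (exp (2 * c * (real k + 1)\<^sup>2)) * (\<integral>\<^sup>+x. ?G x \<partial>lborel)"
      by (rule nn_integral_cmult) measurable
    also have "\<dots> < \<infinity>"
      using nn_integral_prod_abs_powr[OF \<theta>, where 'a = "complex ^ 'n"] by (simp add: ennreal_mult_less_top)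
    finally show "(\<integral>\<^sup>+z\<in>K. ennreal ((cmod (?f z))\<^sup>2) * exp_ereal (- 2 * (ereal c * toric_potential p q z)) \<partial>lborel) < \<infinity>" .
  qed
  then show ?thesis
    unfolding multiplier_ideal_stalk_def by (auto intro!: exI[of _ "ball 0 1"])
qed

lemma monomial_notin_stalk:
  fixes p q :: "'n :: finite"
  assumes pq: "p \<noteq> q" and k: "1 \<le> k"
  shows "germ_at 0 (\<lambda>z. (z $ q) ^ (k - 1))
           \<notin> multiplier_ideal_stalk (\<lambda>z. ereal (real k / (real k + 1)) * toric_potential p q z) 0"
proof
  let ?f = "\<lambda>z :: complex ^ 'n. (z $ q) ^ (k - 1)"
  let ?w = "\<lambda>z. exp_ereal (- 2 * (ereal (real k / (real k + 1)) * toric_potential p q z))"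
  assume "germ_at 0 ?f \<in> multiplier_ideal_stalk (\<lambda>z. ereal (real k / (real k + 1)) * toric_potential p q z) 0"
  then obtain g U where fg: "germ_at 0 ?f = germ_at 0 g" and U: "open U" "0 \<in> U"
    and g: "g \<in> multiplier_ideal_sections (\<lambda>z. ereal (real k / (real k + 1)) * toric_potential p q z) U"
    unfolding multiplier_ideal_stalk_def by auto
  have "?f \<in> germ_at 0 g" unfolding fg[symmetric] by (simp add: germ_at_def)
  then have "\<forall>\<^sub>F z in nhds 0. ?f z = g z" by (simp add: germ_at_def)
  moreover have "\<forall>\<^sub>F z in nhds 0. z \<in> U" using U by (rule eventually_nhds_in_open)
  ultimately have "\<forall>\<^sub>F z in nhds 0. ?f z = g z \<and> z \<in> U" by (rule eventually_conj)
  then obtain d where d: "0 < d" "\<And>z. dist z 0 < d \<Longrightarrow> ?f z = g z \<and> z \<in> U"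
    unfolding eventually_nhds_metric by blast
  then have "cball 0 (d / 2) \<subseteq> U" by (auto simp: dist_norm)
  then have "(\<integral>\<^sup>+z\<in>cball 0 (d / 2). ennreal ((cmod (g z))\<^sup>2) * ?w z \<partial>lborel) < \<infinity>"
    using g by (auto simp: multiplier_ideal_sections_def)
  also have "(\<integral>\<^sup>+z\<in>cball 0 (d / 2). ennreal ((cmod (g z))\<^sup>2) * ?w z \<partial>lborel)
      = (\<integral>\<^sup>+z\<in>cball 0 (d / 2). ennreal ((cmod (?f z))\<^sup>2) * ?w z \<partial>lborel)"
    using d by (intro nn_integral_cong) (auto simp: indicator_def dist_norm)
  also have "\<dots> = \<infinity>" using d(1) by (intro monomial_not_integrable pq k) simp
  finally show False by simp
qed

text \<open>
  The monomials \<open>w ^ (k - 1)\<close> serve twice: they show that each \<open>k / (k + 1)\<close> is a jumping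
  coefficient, and, since some \<open>k / (k + 1)\<close> exceeds any given \<open>c < 1\<close>, that \<open>1\<close> is one.
\<close>

theorem theorem1p1:
  assumes "2 \<le> CARD('n::finite)"
  shows "\<exists>\<phi> :: complex ^ 'n \<Rightarrow> ereal.
           plurisubharmonic_on UNIV \<phi> \<and> is_cluster_point_of_Jump 1 \<phi> 0"
proof -
  obtain p q :: 'n where pq: "p \<noteq> q"
    using assms by (metis UNIV_I card_le_Suc0_iff_eq finite not_less_eq_eq numeral_2_eq_2)
  let ?\<phi> = "toric_potential p q"
  let ?\<xi> = "\<lambda>k. real k / (real k + 1)"
  let ?I = "\<lambda>c. multiplier_ideal_stalk (\<lambda>z. ereal c * ?\<phi> z) 0"
  let ?f = "\<lambda>k. germ_at (0 :: complex ^ 'n) (\<lambda>z. (z $ q) ^ (k - 1))"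
  have anti: "?I \<xi> \<subseteq> ?I c" if "0 \<le> c" "c \<le> \<xi>" for c \<xi>
    using that by (rule multiplier_ideal_stalk_antimono[of _ _ "ball 0 1"]) (auto intro!: toric_potential_nonpos)
  have \<xi>: "0 < ?\<xi> k" "?\<xi> k < 1" if "1 \<le> k" for k using that by (auto simp: field_simps)
  have strict: "?I \<xi> \<subset> ?I c" if "1 \<le> k" "0 \<le> c" "c < ?\<xi> k" "?\<xi> k \<le> \<xi>" for k c \<xi>
    using monomial_in_stalk[OF pq that(1,2,3)] monomial_notin_stalk[OF pq that(1)]
      anti[of "?\<xi> k" \<xi>] anti[of c \<xi>] that by auto
  have ex: "\<exists>k\<ge>1. c < ?\<xi> k" if "c < 1" for c
  proof -
    have "\<forall>\<^sub>F k in sequentially. 1 \<le> k \<and> c < ?\<xi> k"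
      using that by (intro eventually_conj eventually_ge_at_top) real_asymp
    then show ?thesis unfolding eventually_sequentially by blast
  qed
  have jump: "?\<xi> k \<in> Jump ?\<phi> 0" if "1 \<le> k" for k
    unfolding Jump_def using strict[OF that, of _ "?\<xi> k"] \<xi>[OF that] by simp
  have "1 \<in> Jump ?\<phi> 0"
    unfolding Jump_def
  proof (intro CollectI conjI allI impI)
    fix c :: real assume c: "0 \<le> c \<and> c < 1"
    then obtain k where "1 \<le> k" "c < ?\<xi> k" using ex by blast
    then show "?I 1 \<subset> ?I c" using c \<xi>[of k] by (intro strict[of k]) auto
  qed simp
  moreover have "\<forall>\<^sub>F \<epsilon> in at_right 0. \<exists>\<eta>\<in>Jump ?\<phi> 0. 1 - \<epsilon> < \<eta> \<and> \<eta> < 1"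
    using eventually_at_right_less[of 0]
  proof eventually_elim
    case (elim \<epsilon>)
    then obtain k where k: "1 \<le> k" "1 - \<epsilon> < ?\<xi> k" using ex[of "1 - \<epsilon>"] by auto
    then show ?case using jump[OF k(1)] \<xi>[OF k(1)] by blast
  qed
  ultimately show ?thesis
    using plurisubharmonic_toric_potential[of p q] by (auto simp: is_cluster_point_of_Jump_def)
qed

end
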